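(* Let $\delta\in\mathbb C^\times$ and let $(\mathcal A,\cdot)$ be an algebra over $\mathbb C$ (not necessarily associative; $xy$ denotes $x\cdot y$). Define $$x\ast y=\frac12(xy-yx),\qquad \{x,y\}=\frac12(xy+yx).$$ Then $(\mathcal A,\cdot)$ is an admissible $\delta$-mock-Poisson algebra if and only if $(\mathcal A,\ast,\{-,-\})$ is a $\delta$-mock-Poisson algebra.
   Context: An algebra $(\mathcal A,\cdot)$ is an admissible $\delta$-mock-Poisson algebra if for all $x,y,z\in\mathcal A$ $$(1+2\delta)(xy)z-(yx)z+(xz)y-\delta(yz)x+(2\delta-1)(zx)y+3\delta\,x(yz)=0.$$ A mock-Lie algebra is a vector space with a symmetric bilinear product $\{-,-\}$ satisfying $\{\{x,y\},z\}+\{\{y,z\},x\}+\{\{z,x\},y\}=0$. A $\delta$-mock-Poisson algebra is a triple $(\mathcal A,\ast,\{-,-\})$ where $(\mathcal A,\ast)$ is anti-commutative ($x\ast y=-y\ast x$) and anti-associative ($(x\ast y)\ast z=-x\ast(y\ast z)$), $(\mathcal A,\{-,-\})$ is a mock-Lie algebra, and for all $x,y,z\in\mathcal A$ $$\{x\ast y,z\}=-\delta\bigl(x\ast\{y,z\}+\{x,z\}\ast y\bigr).$$ *)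

theory Defs
  imports Complex_Main
begin

text \<open>
  An algebra over the complex numbers: a complex vector space (the whole type, of arbitrary
  dimension) with a bilinear product, not assumed associative, commutative or unital.
\<close>

locale complex_algebra = vector_space scale
  for scale :: "complex \<Rightarrow> 'a::ab_group_add \<Rightarrow> 'a" (infixr \<open>*s\<close> 75) +
  fixes mult :: "'a \<Rightarrow> 'a \<Rightarrow> 'a" (infixl \<open>\<cdot>\<close> 70)
  assumes linear_mult_right: "Vector_Spaces.linear scale scale (\<lambda>y. x \<cdot> y)"
    and linear_mult_left: "Vector_Spaces.linear scale scale (\<lambda>x. x \<cdot> y)"

locale admissible_mock_poisson_algebra = complex_algebra scale mult
  for scale :: "complex \<Rightarrow> 'a::ab_group_add \<Rightarrow> 'a" (infixr \<open>*s\<close> 75)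
    and mult :: "'a \<Rightarrow> 'a \<Rightarrow> 'a" (infixl \<open>\<cdot>\<close> 70) +
  fixes \<delta> :: complex
  assumes admissible:
    "(1 + 2 * \<delta>) *s ((x \<cdot> y) \<cdot> z) - (y \<cdot> x) \<cdot> z + (x \<cdot> z) \<cdot> y
      - \<delta> *s ((y \<cdot> z) \<cdot> x) + (2 * \<delta> - 1) *s ((z \<cdot> x) \<cdot> y)
      + (3 * \<delta>) *s (x \<cdot> (y \<cdot> z)) = 0"

locale mock_lie_algebra = complex_algebra scale br
  for scale :: "complex \<Rightarrow> 'a::ab_group_add \<Rightarrow> 'a" (infixr \<open>*s\<close> 75)
    and br :: "'a \<Rightarrow> 'a \<Rightarrow> 'a" +
  assumes br_symmetric: "br x y = br y x"
    and br_jacobi: "br (br x y) z + br (br y z) x + br (br z x) y = 0"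

locale anticomm_antiassoc_algebra = complex_algebra scale star
  for scale :: "complex \<Rightarrow> 'a::ab_group_add \<Rightarrow> 'a" (infixr \<open>*s\<close> 75)
    and star :: "'a \<Rightarrow> 'a \<Rightarrow> 'a" (infixl \<open>\<star>\<close> 70) +
  assumes star_anticommutative: "x \<star> y = - (y \<star> x)"
    and star_antiassociative: "(x \<star> y) \<star> z = - (x \<star> (y \<star> z))"

locale mock_poisson_algebra =
  star: anticomm_antiassoc_algebra scale star + br: mock_lie_algebra scale br
  for scale :: "complex \<Rightarrow> 'a::ab_group_add \<Rightarrow> 'a" (infixr \<open>*s\<close> 75)
    and star :: "'a \<Rightarrow> 'a \<Rightarrow> 'a" (infixl \<open>\<star>\<close> 70)
    and br :: "'a \<Rightarrow> 'a \<Rightarrow> 'a" +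
  fixes \<delta> :: complex
  assumes mock_leibniz: "br (x \<star> y) z = - (\<delta> *s (x \<star> br y z + br x z \<star> y))"

definition half_commutator ::
    "(complex \<Rightarrow> 'a \<Rightarrow> 'a) \<Rightarrow> ('a \<Rightarrow> 'a \<Rightarrow> 'a) \<Rightarrow> 'a \<Rightarrow> 'a \<Rightarrow> 'a::ab_group_add"
  where "half_commutator scale mult x y = scale (1/2) (mult x y - mult y x)"

definition half_anticommutator ::
    "(complex \<Rightarrow> 'a \<Rightarrow> 'a) \<Rightarrow> ('a \<Rightarrow> 'a \<Rightarrow> 'a) \<Rightarrow> 'a \<Rightarrow> 'a \<Rightarrow> 'a::ab_group_add"
  where "half_anticommutator scale mult x y = scale (1/2) (mult x y + mult y x)"

end

theory Submission
  imports Defs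
begin

text \<open>
  Write \<open>D\<close> for the left-hand side of the admissible identity and \<open>A\<close>, \<open>J\<close>, \<open>L\<close> for the defects of
  anti-associativity, of the Jacobi identity and of the mock Leibniz rule.
  Expanding into the twelve nonassociative monomials that are multilinear in \<open>x\<close>, \<open>y\<close>, \<open>z\<close>
  shows that \<open>D x y z\<close> is a linear combination of values of \<open>A\<close>, \<open>J\<close>, \<open>L\<close>, and that
  \<open>12 \<delta> A\<close>, \<open>12 \<delta> J\<close>, \<open>12 \<delta> L\<close> are linear combinations of the values of \<open>D\<close> at the
  permutations of \<open>x\<close>, \<open>y\<close>, \<open>z\<close>.
\<close>

context vector_space
begin

text \<open>Extend \<open>{v}\<close> to a basis and take the coordinate along \<open>v\<close>,
  which is linear and equals 1 at \<open>v\<close>.\<close>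

lemma exists_separating_functional:
  assumes "v \<noteq> 0"
  obtains f :: "'b \<Rightarrow> 'a"
  where "\<And>x y. f (x + y) = f x + f y" "\<And>c x. f (scale c x) = c * f x" "f v \<noteq> 0"
proof -
  let ?B = "extend_basis {v}"
  have ind: "independent {v}"
    using assms by simp
  have B: "independent ?B" "span ?B = UNIV" "v \<in> ?B"
    using independent_extend_basis[OF ind] span_extend_basis[OF ind]
      extend_basis_superset[OF ind] by auto
  show thesis
    by (rule that[of "\<lambda>w. representation ?B w v"])
      (use B in \<open>simp_all add: representation_add representation_scale representation_basis\<close>)
qed

text \<open>
  Reduces vector identities to identities in the field, where the arithmetic decision
  procedures are available.
\<close>
lemma eq_by_functionals:
  assumes "\<And>f :: 'b \<Rightarrow> 'a. \<lbrakk>\<And>x y. f (x + y) = f x + f y; \<And>x y. f (x - y) = f x - f y;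
      \<And>x. f (- x) = - f x; f 0 = 0; \<And>c x. f (scale c x) = c * f x\<rbrakk> \<Longrightarrow> f u = f v"
  shows "u = v"
proof (rule ccontr)
  assume "u \<noteq> v"
  then have "u - v \<noteq> 0" by simp
  then obtain f :: "'b \<Rightarrow> 'a"
    where f: "\<And>x y. f (x + y) = f x + f y" "\<And>c x. f (scale c x) = c * f x" "f (u - v) \<noteq> 0"
    by (rule exists_separating_functional) blast
  have zero: "f 0 = 0"
    using f(2)[of 0 0] by simp
  have minus: "f (- x) = - f x" for x
    using f(2)[of "- 1" x] by simp
  have diff: "f (x - y) = f x - f y" for x y
    using f(1)[of x "- y"] minus by simp
  have "f u = f v"
    by (rule assms) (use f zero minus diff in auto)
  then show False
    using f(3) diff by simp
qed

end

context complex_algebra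
begin

lemma mult_linear_simps:
  "x \<cdot> (y + z) = x \<cdot> y + x \<cdot> z" "(x + y) \<cdot> z = x \<cdot> z + y \<cdot> z"
  "x \<cdot> (y - z) = x \<cdot> y - x \<cdot> z" "(x - y) \<cdot> z = x \<cdot> z - y \<cdot> z"
  "x \<cdot> (- y) = - (x \<cdot> y)" "(- x) \<cdot> y = - (x \<cdot> y)"
  "x \<cdot> (c *s y) = c *s (x \<cdot> y)" "(c *s x) \<cdot> y = c *s (x \<cdot> y)"
proof -
  interpret r: Vector_Spaces.linear scale scale "\<lambda>y. x \<cdot> y" for x
    by (rule linear_mult_right)
  interpret l: Vector_Spaces.linear scale scale "\<lambda>x. x \<cdot> y" for y
    by (rule linear_mult_left)
  show "x \<cdot> (y + z) = x \<cdot> y + x \<cdot> z" "(x + y) \<cdot> z = x \<cdot> z + y \<cdot> z"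
    "x \<cdot> (y - z) = x \<cdot> y - x \<cdot> z" "(x - y) \<cdot> z = x \<cdot> z - y \<cdot> z"
    "x \<cdot> (- y) = - (x \<cdot> y)" "(- x) \<cdot> y = - (x \<cdot> y)"
    "x \<cdot> (c *s y) = c *s (x \<cdot> y)" "(c *s x) \<cdot> y = c *s (x \<cdot> y)"
    by (fact r.add l.add r.diff l.diff r.neg l.neg r.scale l.scale)+
qed

abbreviation star (infixl \<open>\<star>\<close> 70)
  where "x \<star> y \<equiv> half_commutator scale mult x y"

abbreviation br
  where "br x y \<equiv> half_anticommutator scale mult x y"

lemma complex_algebra_half_commutator: "complex_algebra scale (half_commutator scale mult)"
  by unfold_locales
    (simp_all add: half_commutator_def mult_linear_simps algebra_simps)

lemma complex_algebra_half_anticommutator: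
  "complex_algebra scale (half_anticommutator scale mult)"
  by unfold_locales
    (simp_all add: half_anticommutator_def mult_linear_simps algebra_simps)

definition admissible_defect :: "complex \<Rightarrow> 'a \<Rightarrow> 'a \<Rightarrow> 'a \<Rightarrow> 'a"
  where "admissible_defect \<delta> x y z =
    (1 + 2 * \<delta>) *s ((x \<cdot> y) \<cdot> z) - (y \<cdot> x) \<cdot> z + (x \<cdot> z) \<cdot> y
      - \<delta> *s ((y \<cdot> z) \<cdot> x) + (2 * \<delta> - 1) *s ((z \<cdot> x) \<cdot> y)
      + (3 * \<delta>) *s (x \<cdot> (y \<cdot> z))"

definition antiassoc_defect :: "'a \<Rightarrow> 'a \<Rightarrow> 'a \<Rightarrow> 'a"
  where "antiassoc_defect x y z = (x \<star> y) \<star> z + x \<star> (y \<star> z)"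

definition jacobi_defect :: "'a \<Rightarrow> 'a \<Rightarrow> 'a \<Rightarrow> 'a"
  where "jacobi_defect x y z = br (br x y) z + br (br y z) x + br (br z x) y"

definition leibniz_defect :: "complex \<Rightarrow> 'a \<Rightarrow> 'a \<Rightarrow> 'a \<Rightarrow> 'a"
  where "leibniz_defect \<delta> x y z = br (x \<star> y) z + \<delta> *s (x \<star> br y z + br x z \<star> y)"

lemmas defect_expand =
  admissible_defect_def antiassoc_defect_def jacobi_defect_def leibniz_defect_def
  half_commutator_def half_anticommutator_def mult_linear_simps

text \<open>The three identities that follow invert this one. They rest on symmetry:
  \<open>antiassoc_defect\<close> is unchanged when its outer arguments are swapped and has
  vanishing cyclic sum, \<open>jacobi_defect\<close> is totally symmetric, and
  \<open>leibniz_defect\<close> changes sign when its first two arguments are swapped.\<close>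

lemma admissible_defect_eq:
  "admissible_defect \<delta> x y z =
    (2 + 2 * \<delta>) *s (antiassoc_defect x y z + leibniz_defect \<delta> x y z)
    + (2 - 2 * \<delta>) *s (antiassoc_defect x z y + leibniz_defect \<delta> x z y)
    + (2 * \<delta>) *s (jacobi_defect x y z + leibniz_defect \<delta> y z x)"
  \<comment> \<open>The first \<open>simp\<close> pushes the functional down to the monomials; the
    second compares coefficients, with the values on monomials as atoms.\<close>
  by (rule eq_by_functionals) (simp add: defect_expand, simp add: field_simps)

lemma antiassoc_defect_eq:
  "(12 * \<delta>) *s antiassoc_defect x y z =
    admissible_defect \<delta> x y z - admissible_defect \<delta> x z y
    - admissible_defect \<delta> z x y + admissible_defect \<delta> z y x"
  by (rule eq_by_functionals) (simp add: defect_expand, simp add: field_simps)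

text \<open>Summing \<open>admissible_defect_eq\<close> over all six permutations cancels every
  \<open>antiassoc_defect\<close> and \<open>leibniz_defect\<close>, and leaves six copies of the
  term with coefficient \<open>2 * \<delta>\<close>.\<close>

lemma jacobi_defect_eq:
  "(12 * \<delta>) *s jacobi_defect x y z =
    admissible_defect \<delta> x y z + admissible_defect \<delta> x z y
    + admissible_defect \<delta> y x z + admissible_defect \<delta> y z x
    + admissible_defect \<delta> z x y + admissible_defect \<delta> z y x"
  by (rule eq_by_functionals) (simp add: defect_expand, simp add: field_simps)

lemma leibniz_defect_eq:
  "(12 * \<delta>) *s leibniz_defect \<delta> x y z =
    \<delta> *s (admissible_defect \<delta> x y z + admissible_defect \<delta> x z y
      - admissible_defect \<delta> y x z - admissible_defect \<delta> y z x)
    + admissible_defect \<delta> z x y - admissible_defect \<delta> z y x"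
  by (rule eq_by_functionals) (simp add: defect_expand, simp add: field_simps)

lemma admissible_iff_defect:
  "admissible_mock_poisson_algebra scale mult \<delta> \<longleftrightarrow>
    (\<forall>x y z. admissible_defect \<delta> x y z = 0)"
  using complex_algebra_axioms
  by (simp add: admissible_mock_poisson_algebra_def admissible_mock_poisson_algebra_axioms_def
      admissible_defect_def)

text \<open>Bilinearity, anticommutativity of \<open>star\<close> and symmetry of \<open>br\<close>
  are automatic, so only the three defects remain.\<close>

lemma mock_poisson_iff_defects:
  "mock_poisson_algebra scale (half_commutator scale mult) (half_anticommutator scale mult) \<delta> \<longleftrightarrow>
    (\<forall>x y z. antiassoc_defect x y z = 0 \<and> jacobi_defect x y z = 0 \<and> leibniz_defect \<delta> x y z = 0)"
proof -
  have "x \<star> y = - (y \<star> x)" for x y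
    by (simp add: half_commutator_def flip: scale_minus_right)
  moreover have "br x y = br y x" for x y
    by (simp add: half_anticommutator_def add.commute)
  ultimately show ?thesis
    using complex_algebra_half_commutator complex_algebra_half_anticommutator
    unfolding mock_poisson_algebra_def mock_poisson_algebra_axioms_def
      anticomm_antiassoc_algebra_def anticomm_antiassoc_algebra_axioms_def
      mock_lie_algebra_def mock_lie_algebra_axioms_def
      antiassoc_defect_def jacobi_defect_def leibniz_defect_def eq_neg_iff_add_eq_0
    by blast
qed

lemma admissible_iff_mock_poisson:
  assumes "\<delta> \<noteq> 0"
  shows "admissible_mock_poisson_algebra scale mult \<delta> \<longleftrightarrow>
    mock_poisson_algebra scale (half_commutator scale mult) (half_anticommutator scale mult) \<delta>"
  unfolding admissible_iff_defect mock_poisson_iff_defects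
proof (intro iffI allI conjI)
  fix x y z
  assume D: "\<forall>x y z. admissible_defect \<delta> x y z = 0"
  \<comment> \<open>The inversion formulas determine each defect only up to this factor, which has
    to be cancelled.\<close>
  have "12 * \<delta> \<noteq> 0"
    using assms by simp
  then show "antiassoc_defect x y z = 0" "jacobi_defect x y z = 0" "leibniz_defect \<delta> x y z = 0"
    using antiassoc_defect_eq[of \<delta> x y z] jacobi_defect_eq[of \<delta> x y z]
      leibniz_defect_eq[of \<delta> x y z] D by simp_all
next
  fix x y z
  assume "\<forall>x y z. antiassoc_defect x y z = 0 \<and> jacobi_defect x y z = 0
    \<and> leibniz_defect \<delta> x y z = 0"
  then show "admissible_defect \<delta> x y z = 0"
    by (simp add: admissible_defect_eq)
qed

end

theorem theorem6p14:
  fixes \<delta> :: complex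
    and scale :: "complex \<Rightarrow> 'a::ab_group_add \<Rightarrow> 'a"
    and mult :: "'a \<Rightarrow> 'a \<Rightarrow> 'a"
  assumes "\<delta> \<noteq> 0"
    and "complex_algebra scale mult"
  shows "admissible_mock_poisson_algebra scale mult \<delta> \<longleftrightarrow>
    mock_poisson_algebra scale (half_commutator scale mult) (half_anticommutator scale mult) \<delta>"
  using complex_algebra.admissible_iff_mock_poisson[OF assms(2,1)] .

end
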